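(* Let $\Psi$ be an Orlicz function. (1) Assume that there are positive constants $C_\Psi,c_\Psi$, depending only on $\Psi$, such that for every $N\ge1$, all sequences of i.i.d. real valued, mean zero random variables $X_1,\dots,X_N$ with $\|X_1\|_\infty\le1$, and all $t>0$, $$\mathbb{P}\Big(\sum_{i=1}^N X_i\ge t\Big)\le C_\Psi\exp\Big(-c_\Psi\frac{t}{\|\max_{i\le N}|X_i|\|_\Psi}\ln\Big(1+\frac{t\,\|\max_{i\le N}|X_i|\|_\Psi}{N\,\mathbb{E}X_1^2}\Big)\Big)+\frac{C_\Psi}{\Psi\Big(c_\Psi\frac{t}{\|\max_{i\le N}|X_i|\|_\Psi}\Big)+1}.$$ Then there exists $K>0$ such that for all $s,u\ge K$, $$\psi(su)\le K\big(s\ln(1+s)+s\psi(u)\big).\qquad(\mathrm{HJ})$$ (2) The same conclusion, i.e. the existence of $K>0$ such that (HJ) holds for all $s,u\ge K$, is also true if there exist positive constants $c_\Psi,C_\Psi<\infty$ such that $\Psi(x)\le C_\Psi e^{C_\Psi x}$ for all $x\ge0$ and, for every $N\ge1$, all sequences of i.i.d. real valued, mean zero random variables $X_1,\dots,X_N$ with $\|X_1\|_\infty\le1$, and all $t>0$, $$\mathbb{P}\Big(\sum_{i=1}^N X_i\ge t\Big)\le C_\Psi\exp\Big(-\frac{c_\Psi t^2}{N\,\mathbb{E}X_1^2+t\,\|\max_{i\le N}|X_i|\|_\Psi}\Big)+\frac{C_\Psi}{\Psi\Big(c_\Psi\frac{t}{\|\max_{i\le N}|X_i|\|_\Psi}\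Big)+1}.$$
   Context: An Orlicz function is a function $\Psi\colon[0,\infty)\to[0,\infty)$ which is convex, strictly increasing and satisfies $\Psi(0)=0$. With it one associates $\psi\colon[0,\infty)\to[0,\infty)$ defined by $\Psi(x)=e^{\psi(x)}-1$. For a real random variable $Y$, $\|Y\|_{\Psi}=\inf\{a>0\colon\mathbb{E}\,\Psi(|Y|/a)\le1\}$, and $\|Y\|_\infty$ is the essential supremum of $|Y|$. In the trivial case $X_1=0$ almost surely (when denominators vanish) the displayed inequalities are regarded as satisfied. *)

theory Defs
  imports "HOL-Probability.Probability" "HOL-Probability.Essential_Supremum"
begin

text \<open>
  Functions on \<open>[0,\<infinity>)\<close> are represented by functions on all of \<open>real\<close>; their values at negative
  arguments are unconstrained and never used.
\<close>

definition orlicz_function :: "(real \<Rightarrow> real) \<Rightarrow> bool" where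
  "orlicz_function \<Psi> \<longleftrightarrow>
     \<Psi> \<in> {0..} \<rightarrow> {0..} \<and> convex_on {0..} \<Psi> \<and> strict_mono_on {0..} \<Psi> \<and> \<Psi> 0 = 0"

text \<open>The function \<open>\<psi>\<close> with \<open>\<Psi> x = exp (\<psi> x) - 1\<close>.\<close>

definition orlicz_exponent :: "(real \<Rightarrow> real) \<Rightarrow> real \<Rightarrow> real" where
  "orlicz_exponent \<Psi> x = ln (1 + \<Psi> x)"

text \<open>
  The expectation of the nonnegative variable \<open>\<Psi> (\<bar>Y\<bar> / a)\<close> is a Lebesgue integral with values in
  \<open>[0,\<infinity>]\<close>, so that an infinite expectation does not count as \<open>\<le> 1\<close>. The infimum is the expected one
  whenever some \<open>a\<close> is admissible, in particular for every essentially bounded \<open>Y\<close>; for variables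
  of infinite norm the real-valued infimum is unspecified.
\<close>

definition orlicz_norm :: "'a measure \<Rightarrow> (real \<Rightarrow> real) \<Rightarrow> ('a \<Rightarrow> real) \<Rightarrow> real" where
  "orlicz_norm M \<Psi> Y = Inf {a. 0 < a \<and> (\<integral>\<^sup>+\<omega>. ennreal (\<Psi> (\<bar>Y \<omega>\<bar> / a)) \<partial>M) \<le> 1}"

definition sup_norm :: "'a measure \<Rightarrow> ('a \<Rightarrow> real) \<Rightarrow> ereal" where
  "sup_norm M Y = esssup M (\<lambda>\<omega>. ereal \<bar>Y \<omega>\<bar>)"

definition iid_vars :: "'a measure \<Rightarrow> nat \<Rightarrow> (nat \<Rightarrow> 'a \<Rightarrow> real) \<Rightarrow> bool" where
  "iid_vars M N X \<longleftrightarrow>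
     prob_space.indep_vars M (\<lambda>_. borel) X {1..N} \<and>
     (\<forall>i\<in>{1..N}. distr M borel (X i) = distr M borel (X 1))"

text \<open>
  A quantifier over all probability spaces cannot range over types inside a hypothesis. The sample
  points are therefore taken from \<open>nat \<Rightarrow> real\<close>, with an arbitrary \<open>\<sigma>\<close>-algebra and probability
  measure. This loses no generality: the law of any sequence of real random variables is carried by
  this type, and the inequalities depend only on the law.

  Since \<open>X 1\<close> is essentially bounded, it is integrable and \<open>E X\<^sub>1 = 0\<close> has its usual meaning. The
  degenerate case \<open>X\<^sub>1 = 0\<close> almost surely, where the tail inequalities are satisfied by convention,
  is excluded here.
\<close>

definition admissible :: "(nat \<Rightarrow> real) measure \<Rightarrow> nat \<Rightarrow> (nat \<Rightarrow> (nat \<Rightarrow> real) \<Rightarrow> real) \<Rightarrow> bool" where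
  "admissible M N X \<longleftrightarrow>
     prob_space M \<and> iid_vars M N X \<and>
     prob_space.expectation M (X 1) = 0 \<and> sup_norm M (X 1) \<le> 1 \<and>
     \<not> (AE \<omega> in M. X 1 \<omega> = 0)"

definition max_abs :: "nat \<Rightarrow> (nat \<Rightarrow> 'a \<Rightarrow> real) \<Rightarrow> 'a \<Rightarrow> real" where
  "max_abs N X \<omega> = (MAX i\<in>{1..N}. \<bar>X i \<omega>\<bar>)"

definition HJ :: "(real \<Rightarrow> real) \<Rightarrow> real \<Rightarrow> bool" where
  "HJ \<Psi> K \<longleftrightarrow>
     (\<forall>s u. s \<ge> K \<longrightarrow> u \<ge> K \<longrightarrow>
        orlicz_exponent \<Psi> (s * u) \<le> K * (s * ln (1 + s) + s * orlicz_exponent \<Psi> u))"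

end

theory Submission
  imports Defs "HOL-Real_Asymp.Real_Asymp"
begin

text \<open>
  One family of samples suffices. Let \<open>X\<^sub>1, \<dots>, X\<^sub>N\<close> be independent with values in
  \<open>{-1, 0, 1}\<close>, symmetric, and nonzero with a probability \<open>p\<close> chosen so that some \<open>X\<^sub>i\<close> is
  nonzero with probability exactly \<open>1 / \<Psi> u\<close>. The maximum of the \<open>\<bar>X\<^sub>i\<bar>\<close> is then an indicator
  of Orlicz norm \<open>1 / u\<close>, and \<open>N p\<close> lies between \<open>1 / \<Psi> u\<close> and \<open>2 / \<Psi> u\<close>. Take \<open>t = N\<close>:
  the sum reaches \<open>N\<close> when all the variables equal \<open>1\<close>, which has probability
  \<open>(p / 2)\<^sup>N \<ge> exp (- L)\<close> with \<open>L = N ln (2 N \<Psi> u)\<close>. Up to constant factors, \<open>L\<close> is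
  \<open>N ln N + N \<psi> u\<close>, the right-hand side of (HJ) at \<open>s = N\<close>.

  A tail bound at \<open>t = N\<close> is a sum of two terms, so one of them is at least \<open>exp (- L) / 2\<close>
  (\<open>tail_bound_dichotomy\<close>). If it is the term \<open>C / (\<Psi> (c N u) + 1) = C exp (- \<psi> (c N u))\<close>,
  then \<open>\<psi> (c N u) \<le> L + ln (2 C)\<close>, which is (HJ) after rounding \<open>s / c\<close> up to an integer
  \<open>N\<close> (\<open>HJ_of_sample_bound\<close>). It remains to treat the other term. In (1) its exponent is at
  least of order \<open>u N ln (1 + N \<Psi> u / (2 u))\<close>, which exceeds \<open>L + ln (2 C)\<close> for all large
  \<open>u\<close>, uniformly in \<open>N\<close>, because \<open>\<Psi> u / u\<close> is bounded below by convexity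
  (\<open>bennett_exponent_dominates\<close>); so this case does not occur. In (2) its exponent is at least of
  order \<open>N u\<close> and it may occur, but then \<open>N u\<close> is at most of order \<open>L + 1\<close>, and the
  exponential growth of \<open>\<Psi>\<close> gives \<open>\<psi> (c N u) = O(1 + N u) = O(L + 1)\<close>.
\<close>

section \<open>Independent symmetric signs switched on with small probability\<close>

definition signed_bernoulli :: "real \<Rightarrow> real pmf" where
  "signed_bernoulli p =
     bernoulli_pmf p \<bind> (\<lambda>b. if b then pmf_of_set {-1, 1} else return_pmf 0)"

lemma set_signed_bernoulli: "set_pmf (signed_bernoulli p) \<subseteq> {-1, 0, 1}"
  by (auto simp: signed_bernoulli_def split: if_splits)

lemma pmf_signed_bernoulli:
  assumes "0 \<le> p" "p \<le> 1"
  shows "pmf (signed_bernoulli p) 1 = p / 2" "pmf (signed_bernoulli p) (-1) = p / 2"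
    "pmf (signed_bernoulli p) 0 = 1 - p"
  using assms by (simp_all add: signed_bernoulli_def pmf_bind indicator_def)

lemma moments_signed_bernoulli:
  assumes "0 \<le> p" "p \<le> 1"
  shows "(\<integral>x. x \<partial>signed_bernoulli p) = 0" "(\<integral>x. x\<^sup>2 \<partial>signed_bernoulli p) = p"
  using set_signed_bernoulli[of p] assms
  by (subst integral_measure_pmf_real[of "{-1, 0, 1}"]; force simp: pmf_signed_bernoulli)+

definition sign_sample :: "nat \<Rightarrow> real \<Rightarrow> (nat \<Rightarrow> real) pmf" where
  "sign_sample N p = Pi_pmf {1..N} 0 (\<lambda>_. signed_bernoulli p)"

lemma map_sign_sample:
  "i \<in> {1..N} \<Longrightarrow> map_pmf (\<lambda>\<omega>. \<omega> i) (sign_sample N p) = signed_bernoulli p"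
  by (auto simp: sign_sample_def Pi_pmf_component)

lemma sign_sample_values:
  assumes "\<omega> \<in> set_pmf (sign_sample N p)" "i \<in> {1..N}"
  shows "\<omega> i \<in> {-1, 0, 1}"
proof -
  have "\<omega> i \<in> set_pmf (map_pmf (\<lambda>\<omega>. \<omega> i) (sign_sample N p))"
    using assms(1) by simp
  then show ?thesis
    using set_signed_bernoulli assms(2) by (auto simp: map_sign_sample simp del: set_map_pmf)
qed

lemma moments_sign_sample:
  assumes "0 \<le> p" "p \<le> 1" "i \<in> {1..N}"
  shows "(\<integral>\<omega>. \<omega> i \<partial>sign_sample N p) = 0" "(\<integral>\<omega>. (\<omega> i)\<^sup>2 \<partial>sign_sample N p) = p"
  using moments_signed_bernoulli[OF assms(1,2)]
  unfolding map_sign_sample[OF assms(3), symmetric] by simp_all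

lemma admissible_sign_sample:
  assumes "0 < p" "p \<le> 1" "1 \<le> N"
  shows "admissible (measure_pmf (sign_sample N p)) N (\<lambda>i \<omega>. \<omega> i)"
proof -
  have one: "1 \<in> {1..N}"
    using assms by simp
  have "prob_space.indep_vars (sign_sample N p) (\<lambda>_. borel) (\<lambda>i \<omega>. \<omega> i) {1..N}"
    unfolding sign_sample_def
    by (rule prob_space.indep_vars_compose2[OF _ indep_vars_Pi_pmf, where Y = "\<lambda>_ x. x"])
       (auto simp: measure_pmf.prob_space_axioms)
  moreover have "distr (sign_sample N p) borel (\<lambda>\<omega>. \<omega> i) = distr (signed_bernoulli p) borel (\<lambda>x. x)"
    if "i \<in> {1..N}" for i
    unfolding map_sign_sample[OF that, symmetric] map_pmf_rep_eq
    by (subst distr_distr) (auto simp: comp_def)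
  ultimately have "iid_vars (sign_sample N p) N (\<lambda>i \<omega>. \<omega> i)"
    using one by (auto simp: iid_vars_def)
  moreover have "sup_norm (sign_sample N p) (\<lambda>\<omega>. \<omega> 1) \<le> 1"
    unfolding sup_norm_def
    using sign_sample_values[OF _ one] by (intro esssup_I) (fastforce intro!: AE_pmfI)+
  moreover have "\<not> (AE \<omega> in sign_sample N p. \<omega> 1 = 0)"
  proof
    assume "AE \<omega> in sign_sample N p. \<omega> 1 = 0"
    then have "(\<integral>\<omega>. (\<omega> 1)\<^sup>2 \<partial>sign_sample N p) = 0"
      by (intro integral_eq_zero_AE) auto
    then show False
      using moments_sign_sample(2)[OF _ _ one, of p] assms by simp
  qed
  ultimately show ?thesis
    using assms moments_sign_sample(1)[OF _ _ one, of p]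
    by (simp add: admissible_def measure_pmf.prob_space_axioms)
qed

text \<open>
  The maximum takes only the values \<open>0\<close> and \<open>1\<close>, so its Orlicz norm depends on nothing but the
  probability that the sample vanishes identically.
\<close>

lemma max_abs_sign_sample:
  assumes "\<omega> \<in> set_pmf (sign_sample N p)" "1 \<le> N"
  shows "max_abs N (\<lambda>i \<omega>. \<omega> i) \<omega> = (if \<forall>i\<in>{1..N}. \<omega> i = 0 then 0 else 1)"
proof (cases "\<forall>i\<in>{1..N}. \<omega> i = 0")
  case True
  have "(\<lambda>i. \<bar>\<omega> i\<bar>) ` {1..N} = {0}"
    using True assms(2) by (auto simp: image_iff)
  then show ?thesis
    using True by (simp add: max_abs_def)
next
  case False
  then obtain i where "i \<in> {1..N}" "\<omega> i \<noteq> 0"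
    by blast
  moreover have "\<bar>\<omega> j\<bar> \<le> 1" if "j \<in> {1..N}" for j
    using sign_sample_values[OF assms(1) that] by auto
  moreover have "\<bar>\<omega> i\<bar> = 1"
    using sign_sample_values[OF assms(1), of i] calculation by auto
  ultimately have "Max ((\<lambda>i. \<bar>\<omega> i\<bar>) ` {1..N}) = 1"
    by (intro Max_eqI) force+
  then show ?thesis
    using False by (simp add: max_abs_def)
qed

lemma prob_max_abs_sign_sample:
  assumes "0 \<le> p" "p \<le> 1" "1 \<le> N"
  shows "measure (sign_sample N p) {\<omega>. max_abs N (\<lambda>i \<omega>. \<omega> i) \<omega> \<noteq> 0} = 1 - (1 - p) ^ N"
proof -
  have "measure (sign_sample N p) {\<omega>. max_abs N (\<lambda>i \<omega>. \<omega> i) \<omega> \<noteq> 0}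
      = measure (sign_sample N p) (UNIV - Pi {1..N} (\<lambda>_. {0}))"
    by (intro measure_pmf.finite_measure_eq_AE AE_pmfI) (auto simp: max_abs_sign_sample[OF _ assms(3)] Pi_iff)
  also have "\<dots> = 1 - measure (sign_sample N p) (Pi {1..N} (\<lambda>_. {0}))"
    using measure_pmf.prob_compl[of "Pi {1..N} (\<lambda>_. {0})" "sign_sample N p"] by simp
  also have "\<dots> = 1 - (1 - p) ^ N"
    using assms
    by (simp add: sign_sample_def measure_Pi_pmf_Pi measure_pmf_single pmf_signed_bernoulli)
  finally show ?thesis .
qed

text \<open>
  Requiring all \<open>N\<close> variables to equal \<open>1\<close> is cheap enough: with \<open>N p\<close> of order
  \<open>1 / \<Psi> u\<close>, the cost per variable is \<open>ln N + ln (\<Psi> u)\<close> up to a constant, as (HJ) allows.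
\<close>

lemma prob_sum_sign_sample:
  assumes "0 \<le> p" "p \<le> 1"
  shows "(p / 2) ^ N \<le> measure (sign_sample N p) {\<omega>. (\<Sum>i=1..N. \<omega> i) \<ge> real N}"
proof -
  have "(p / 2) ^ N = measure (sign_sample N p) (Pi {1..N} (\<lambda>_. {1}))"
    using assms
    by (simp add: sign_sample_def measure_Pi_pmf_Pi measure_pmf_single pmf_signed_bernoulli)
  also have "\<dots> \<le> measure (sign_sample N p) {\<omega>. (\<Sum>i=1..N. \<omega> i) \<ge> real N}"
    by (intro measure_pmf.finite_measure_mono) (auto simp: Pi_iff)
  finally show ?thesis .
qed

section \<open>Orlicz functions and norms\<close>

text \<open>
  Convexity on the segment from \<open>0\<close> to \<open>u\<close>, at the point \<open>1\<close>. This is the only lower bound on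
  the growth of a general Orlicz function that enters the argument.
\<close>

lemma orlicz_function_ge_linear:
  assumes "orlicz_function \<Psi>" "1 \<le> u"
  shows "u * \<Psi> 1 \<le> \<Psi> u"
proof -
  have "\<Psi> ((1 - 1 / u) *\<^sub>R 0 + (1 / u) *\<^sub>R u) \<le> (1 - 1 / u) * \<Psi> 0 + (1 / u) * \<Psi> u"
    using assms by (intro convex_onD[where A = "{0..}"]) (auto simp: orlicz_function_def)
  then show ?thesis
    using assms by (simp add: orlicz_function_def field_simps)
qed

lemma orlicz_function_pos:
  assumes "orlicz_function \<Psi>" "0 < x"
  shows "0 < \<Psi> x"
  using assms strict_mono_onD[of "{0..}" \<Psi> 0 x] by (auto simp: orlicz_function_def)

lemma orlicz_function_eventually_ge_2:
  assumes \<Psi>: "orlicz_function \<Psi>"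
  shows "\<forall>\<^sub>F u in at_top. 2 \<le> \<Psi> u"
proof -
  have "\<forall>\<^sub>F u in at_top. 2 \<le> u * \<Psi> 1"
    using orlicz_function_pos[OF \<Psi>, of 1] by real_asymp
  moreover have "\<forall>\<^sub>F u in at_top. (1 :: real) \<le> u"
    by real_asymp
  ultimately show ?thesis
    by eventually_elim (use orlicz_function_ge_linear[OF \<Psi>] in fastforce)
qed

lemma orlicz_exponent_mono:
  assumes "orlicz_function \<Psi>" "0 \<le> x" "x \<le> y"
  shows "orlicz_exponent \<Psi> x \<le> orlicz_exponent \<Psi> y"
proof -
  have "\<Psi> x \<le> \<Psi> y"
    using assms strict_mono_on_leD[of "{0..}" \<Psi> x y] by (auto simp: orlicz_function_def)
  moreover have "0 \<le> \<Psi> x"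
    using assms by (auto simp: orlicz_function_def)
  ultimately show ?thesis
    by (simp add: orlicz_exponent_def)
qed

text \<open>
  For an indicator of an event of probability \<open>q\<close> the condition \<open>E \<Psi> (\<bar>Y\<bar> / a) \<le> 1\<close> reads
  \<open>q \<Psi> (1 / a) \<le> 1\<close>; with \<open>q = 1 / \<Psi> u\<close> strict monotonicity turns it into \<open>1 / a \<le> u\<close>.
\<close>

lemma orlicz_norm_zero_one:
  fixes M :: "'a pmf"
  assumes \<Psi>: "orlicz_function \<Psi>" and u: "0 < u"
    and Y: "\<And>\<omega>. \<omega> \<in> set_pmf M \<Longrightarrow> Y \<omega> \<in> {0, 1}"
    and prob: "measure M {\<omega>. Y \<omega> \<noteq> 0} = 1 / \<Psi> u"
  shows "orlicz_norm M \<Psi> Y = 1 / u"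
proof -
  have pos: "0 < \<Psi> x" if "0 < x" for x
    using orlicz_function_pos[OF \<Psi> that] .
  have "(\<integral>\<^sup>+\<omega>. ennreal (\<Psi> (\<bar>Y \<omega>\<bar> / a)) \<partial>M) = ennreal (\<Psi> (1 / a) / \<Psi> u)" if a: "0 < a" for a
  proof -
    have "(\<integral>\<^sup>+\<omega>. ennreal (\<Psi> (\<bar>Y \<omega>\<bar> / a)) \<partial>M)
        = (\<integral>\<^sup>+\<omega>. ennreal (\<Psi> (1 / a)) * indicator {\<omega>. Y \<omega> \<noteq> 0} \<omega> \<partial>M)"
    proof (intro nn_integral_cong_AE AE_pmfI)
      fix \<omega> assume "\<omega> \<in> set_pmf M"
      from Y[OF this] show "ennreal (\<Psi> (\<bar>Y \<omega>\<bar> / a))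
          = ennreal (\<Psi> (1 / a)) * indicator {\<omega>. Y \<omega> \<noteq> 0} \<omega>"
        using \<Psi> by (auto simp: orlicz_function_def)
    qed
    also have "\<dots> = ennreal (\<Psi> (1 / a)) * ennreal (1 / \<Psi> u)"
      by (simp add: nn_integral_cmult_indicator measure_pmf.emeasure_eq_measure prob)
    finally show ?thesis
      using pos[OF u] pos[of "1 / a"] a by (simp add: ennreal_mult[symmetric])
  qed
  moreover have "\<Psi> (1 / a) / \<Psi> u \<le> 1 \<longleftrightarrow> 1 / u \<le> a" if a: "0 < a" for a
  proof -
    have "\<Psi> (1 / a) / \<Psi> u \<le> 1 \<longleftrightarrow> \<Psi> (1 / a) \<le> \<Psi> u"
      using pos[OF u] by simp
    also have "\<dots> \<longleftrightarrow> 1 / a \<le> u"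
      using \<Psi> a u by (intro strict_mono_on_less_eq[of "{0..}"]) (auto simp: orlicz_function_def)
    finally show ?thesis
      using a u by (simp add: field_simps)
  qed
  moreover have "0 < 1 / u"
    using u by simp
  ultimately have "0 < a \<and> (\<integral>\<^sup>+\<omega>. ennreal (\<Psi> (\<bar>Y \<omega>\<bar> / a)) \<partial>M) \<le> 1 \<longleftrightarrow> 1 / u \<le> a" for a
    by (metis ennreal_le_1 less_le_trans)
  then have "{a. 0 < a \<and> (\<integral>\<^sup>+\<omega>. ennreal (\<Psi> (\<bar>Y \<omega>\<bar> / a)) \<partial>M) \<le> 1} = {1 / u..}"
    by auto
  then show ?thesis
    by (simp add: orlicz_norm_def)
qed

section \<open>The extremal sample\<close>

text \<open>
  The probability \<open>q\<close> of a nonzero maximum is prescribed exactly, so that the Orlicz norm comes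
  out as exactly \<open>1 / u\<close>, and \<open>N p\<close> is then known up to a factor \<open>2\<close>. Both estimates come from
  the Bernoulli inequality: the lower one from \<open>(1 - p)\<^sup>N \<ge> 1 - N p\<close>, the upper one from
  \<open>(1 - p)\<^sup>N (1 + N p) \<le> (1 - p\<^sup>2)\<^sup>N \<le> 1\<close>, that is \<open>N p \<le> q / (1 - q)\<close>.
\<close>

lemma switch_probability_exists:
  fixes q :: real
  assumes q: "0 < q" "q \<le> 1 / 2" and N: "1 \<le> N"
  obtains p where "0 < p" "p \<le> 1" "1 - (1 - p) ^ N = q" "q \<le> real N * p" "real N * p \<le> 2 * q"
proof -
  define r where "r = root N (1 - q)"
  define p where "p = 1 - r"
  have r: "r ^ N = 1 - q" "0 < r" "r < 1"
    using q N by (auto simp: r_def)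
  have "1 + real N * (- p) \<le> (1 + (- p)) ^ N"
    using r by (intro Bernoulli_inequality) (simp add: p_def)
  then have lower: "q \<le> real N * p"
    using r by (simp add: p_def algebra_simps)
  have "(1 + real N * p) * (1 - q) \<le> (1 + p) ^ N * (1 - q)"
    using q r by (intro mult_right_mono Bernoulli_inequality) (auto simp: p_def)
  also have "\<dots> = ((1 + p) * (1 - p)) ^ N"
    by (simp add: r(1)[symmetric] p_def power_mult_distrib)
  also have "\<dots> \<le> 1"
  proof (rule power_le_one)
    show "(1 + p) * (1 - p) \<le> 1"
      by (simp add: algebra_simps)
  qed (use r in \<open>simp add: p_def\<close>)
  finally have "real N * p * (1 - q) \<le> q"
    by (simp add: algebra_simps)
  moreover have "real N * p * (1 / 2) \<le> real N * p * (1 - q)"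
    using q r by (intro mult_left_mono) (auto simp: p_def)
  ultimately have "real N * p \<le> 2 * q"
    by simp
  then show thesis
    using r lower by (intro that[of p]) (auto simp: p_def)
qed

lemma extremal_sample:
  assumes \<Psi>: "orlicz_function \<Psi>" and u: "0 < u" "2 \<le> \<Psi> u" and N: "1 \<le> N"
  obtains M X where "admissible M N X" "orlicz_norm M \<Psi> (max_abs N X) = 1 / u"
    "0 < prob_space.expectation M (\<lambda>\<omega>. (X 1 \<omega>)\<^sup>2)"
    "real N * prob_space.expectation M (\<lambda>\<omega>. (X 1 \<omega>)\<^sup>2) \<le> 2 / \<Psi> u"
    "exp (- (real N * ln (2 * real N * \<Psi> u)))
       \<le> measure M {\<omega> \<in> space M. (\<Sum>i=1..N. X i \<omega>) \<ge> real N}"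
proof -
  obtain p where p: "0 < p" "p \<le> 1" "1 - (1 - p) ^ N = 1 / \<Psi> u" "1 / \<Psi> u \<le> real N * p"
    "real N * p \<le> 2 * (1 / \<Psi> u)"
    using u N by (auto intro: switch_probability_exists[of "1 / \<Psi> u" N])
  let ?M = "sign_sample N p"
  have one: "1 \<in> {1..N}"
    using N by simp
  have norm: "orlicz_norm ?M \<Psi> (max_abs N (\<lambda>i \<omega>. \<omega> i)) = 1 / u"
    using p N u by (intro orlicz_norm_zero_one[OF \<Psi>])
      (auto simp: max_abs_sign_sample prob_max_abs_sign_sample)
  have "exp (- (real N * ln (2 * real N * \<Psi> u))) = (1 / (2 * real N * \<Psi> u)) ^ N"
    using u N by (simp add: exp_minus exp_of_nat_mult power_one_over inverse_eq_divide)
  also have "\<dots> \<le> (p / 2) ^ N"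
    using p u N by (intro power_mono) (auto simp: field_simps)
  also have "\<dots> \<le> measure ?M {\<omega> \<in> space ?M. (\<Sum>i=1..N. \<omega> i) \<ge> real N}"
    using prob_sum_sign_sample[of p N] p by simp
  finally show thesis
    using that[of ?M "\<lambda>i \<omega>. \<omega> i"] admissible_sign_sample[OF p(1,2) N] norm p
      moments_sign_sample(2)[OF _ p(2) one] by simp
qed

section \<open>From tail bounds to the growth condition\<close>

text \<open>
  Absorbs an additive constant of either sign into a multiplicative one.
\<close>

lemma add_le_mult_abs:
  fixes x D :: real
  assumes "0 \<le> x"
  shows "x + D \<le> (1 + \<bar>D\<bar>) * (x + 1)"
proof -
  have "0 \<le> \<bar>D\<bar> * x"
    using assms by simp
  moreover have "(1 + \<bar>D\<bar>) * (x + 1) = x + \<bar>D\<bar> + \<bar>D\<bar> * x + 1"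
    by (simp add: algebra_simps)
  ultimately show ?thesis
    by linarith
qed

text \<open>
  Tests a tail bound of the form \<open>C exp (- E) + C / (\<Psi> (c t / m) + 1)\<close> on the extremal sample at
  \<open>t = N\<close>. The exponent \<open>E\<close> is a parameter, a function of the sample size, the variance of one
  variable and the norm \<open>m\<close> of the maximum, so that both parts of the theorem are instances.
\<close>

lemma tail_bound_dichotomy:
  fixes E :: "nat \<Rightarrow> real \<Rightarrow> real \<Rightarrow> real"
  assumes \<Psi>: "orlicz_function \<Psi>" and C: "0 < C" and c: "0 < c"
    and tail: "\<And>M X. admissible M N X \<Longrightarrow>
      measure M {\<omega> \<in> space M. (\<Sum>i=1..N. X i \<omega>) \<ge> real N}
        \<le> C * exp (- E N (prob_space.expectation M (\<lambda>\<omega>. (X 1 \<omega>)\<^sup>2))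
                        (orlicz_norm M \<Psi> (max_abs N X)))
          + C / (\<Psi> (c * (real N / orlicz_norm M \<Psi> (max_abs N X))) + 1)"
    and N: "1 \<le> N" and u: "0 < u" "2 \<le> \<Psi> u"
  obtains v where "0 < v" "real N * v \<le> 2 / \<Psi> u"
    "E N v (1 / u) \<le> real N * ln (2 * real N * \<Psi> u) + ln (2 * C)
     \<or> orlicz_exponent \<Psi> (c * real N * u) \<le> real N * ln (2 * real N * \<Psi> u) + ln (2 * C)"
proof -
  obtain M X where MX: "admissible M N X" "orlicz_norm M \<Psi> (max_abs N X) = 1 / u"
    "0 < prob_space.expectation M (\<lambda>\<omega>. (X 1 \<omega>)\<^sup>2)"
    "real N * prob_space.expectation M (\<lambda>\<omega>. (X 1 \<omega>)\<^sup>2) \<le> 2 / \<Psi> u"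
    "exp (- (real N * ln (2 * real N * \<Psi> u)))
       \<le> measure M {\<omega> \<in> space M. (\<Sum>i=1..N. X i \<omega>) \<ge> real N}"
    using extremal_sample[OF \<Psi> u N] by blast
  define v where "v = prob_space.expectation M (\<lambda>\<omega>. (X 1 \<omega>)\<^sup>2)"
  define L where "L = real N * ln (2 * real N * \<Psi> u)"
  define G where "G = orlicz_exponent \<Psi> (c * real N * u)"
  have "0 < \<Psi> (c * real N * u)"
    using c N u by (intro orlicz_function_pos[OF \<Psi>]) simp
  then have "C / (\<Psi> (c * real N * u) + 1) = C * exp (- G)"
    by (simp add: G_def orlicz_exponent_def exp_minus divide_inverse add.commute)
  then have le: "exp (- L) \<le> C * exp (- E N v (1 / u)) + C * exp (- G)"
    using MX(5) tail[OF MX(1)] by (simp add: MX(2) v_def L_def mult.assoc)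
  have small: "a \<le> L + ln (2 * C)" if "exp (- L) \<le> 2 * C * exp (- a)" for a
  proof -
    have "ln (exp (- L)) \<le> ln (2 * C * exp (- a))"
      using that C by (subst ln_le_cancel_iff) auto
    then show ?thesis
      using C by (simp add: ln_mult)
  qed
  have "E N v (1 / u) \<le> L + ln (2 * C) \<or> G \<le> L + ln (2 * C)"
  proof (cases "C * exp (- G) \<le> C * exp (- E N v (1 / u))")
    case True
    then show ?thesis
      using le by (intro disjI1 small) linarith
  next
    case False
    then show ?thesis
      using le by (intro disjI2 small) linarith
  qed
  then show thesis
    using that MX(3,4) by (simp add: v_def L_def G_def)
qed

text \<open>
  Passage from integers \<open>N\<close> to real \<open>s\<close>: with \<open>N\<close> the integer obtained by rounding \<open>s / c\<close>
  up, \<open>s u \<le> c N u\<close> and \<open>N\<close> is still at most a constant times \<open>s\<close>. Additive constants are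
  absorbed because \<open>\<psi> u \<ge> ln 3 \<ge> 1\<close> as soon as \<open>\<Psi> u \<ge> 2\<close>.
\<close>

lemma HJ_of_sample_bound:
  assumes \<Psi>: "orlicz_function \<Psi>" and c: "0 < c" and B: "0 < B" and u0: "1 \<le> u0"
    and ge2: "\<And>u. u0 \<le> u \<Longrightarrow> 2 \<le> \<Psi> u"
    and bound: "\<And>N u. 1 \<le> N \<Longrightarrow> u0 \<le> u \<Longrightarrow>
      orlicz_exponent \<Psi> (c * real N * u) \<le> B * (real N * ln (2 * real N * \<Psi> u) + 1)"
  shows "\<exists>K>0. HJ \<Psi> K"
proof -
  define b where "b = 1 / c + 1"
  define a where "a = ln (2 * b) + 1"
  have b: "1 \<le> b"
    using c by (simp add: b_def)
  then have a: "1 \<le> a"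
    by (simp add: a_def)
  define K where "K = max u0 (B * (b * a + 1))"
  have K: "u0 \<le> K" "B * (b * a + 1) \<le> K" "1 \<le> K"
    using u0 by (auto simp: K_def)
  have "orlicz_exponent \<Psi> (s * u) \<le> K * (s * ln (1 + s) + s * orlicz_exponent \<Psi> u)"
    if s: "K \<le> s" and u: "K \<le> u" for s u
  proof -
    define N where "N = nat \<lceil>s / c\<rceil>"
    define g where "g = orlicz_exponent \<Psi> u"
    have s1: "1 \<le> s" and u1: "u0 \<le> u" "1 \<le> u"
      using s u K by auto
    have Psi_u: "2 \<le> \<Psi> u"
      using ge2 u1 by simp
    have "0 < s / c"
      using s1 c by simp
    then have N: "s / c \<le> real N" "real N \<le> s / c + 1" "1 \<le> N"
      unfolding N_def by linarith+
    have Nb: "real N \<le> b * s"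
      using N(2) s1 by (simp add: b_def field_simps)
    have "exp 1 \<le> 1 + \<Psi> u"
      using exp_le Psi_u by linarith
    then have g1: "1 \<le> g"
      unfolding g_def orlicz_exponent_def using Psi_u by (subst ln_ge_iff) auto
    have sum1: "1 \<le> ln (1 + s) + g"
      using g1 ln_ge_zero[of "1 + s"] s1 by linarith
    have "real N \<le> b * (1 + s)"
      using Nb b by (simp add: algebra_simps)
    then have "2 * real N * \<Psi> u \<le> (2 * b * (1 + s)) * (1 + \<Psi> u)"
      unfolding mult.assoc[of 2] using Psi_u b s1 by (intro mult_mono) auto
    then have "ln (2 * real N * \<Psi> u) \<le> ln (2 * b * (1 + s) * (1 + \<Psi> u))"
      using N(3) Psi_u by (intro ln_mono) auto
    also have "\<dots> = ln (2 * b) + ln (1 + s) + g"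
      using b s1 Psi_u by (simp add: ln_mult g_def orlicz_exponent_def)
    finally have "ln (2 * real N * \<Psi> u) \<le> ln (2 * b) + ln (1 + s) + g" .
    also have "\<dots> \<le> a * (ln (1 + s) + g)"
    proof -
      have "0 \<le> ln (2 * b) * (ln (1 + s) + g - 1)"
        using b sum1 by (intro mult_nonneg_nonneg) auto
      then show ?thesis
        by (simp add: a_def algebra_simps)
    qed
    finally have ln_le: "ln (2 * real N * \<Psi> u) \<le> a * (ln (1 + s) + g)" .
    have "orlicz_exponent \<Psi> (s * u) \<le> orlicz_exponent \<Psi> (c * real N * u)"
      using N(1) c s1 u1 by (intro orlicz_exponent_mono[OF \<Psi>]) (auto simp: field_simps)
    also have "\<dots> \<le> B * (real N * ln (2 * real N * \<Psi> u) + 1)"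
      using bound N(3) u1 by simp
    also have "\<dots> \<le> B * (b * s * (a * (ln (1 + s) + g)) + s * (ln (1 + s) + g))"
    proof -
      have "1 * 1 \<le> s * (ln (1 + s) + g)"
        using s1 sum1 by (intro mult_mono) auto
      moreover have "real N * ln (2 * real N * \<Psi> u) \<le> b * s * (a * (ln (1 + s) + g))"
        using Nb ln_le N(3) Psi_u b s1 a sum1 by (intro mult_mono ln_ge_zero) (auto intro: mult_ge1_I)
      ultimately show ?thesis
        using B by (intro mult_left_mono add_mono) auto
    qed
    also have "\<dots> = B * (b * a + 1) * (s * ln (1 + s) + s * g)"
      by (simp add: algebra_simps)
    also have "\<dots> \<le> K * (s * ln (1 + s) + s * g)"
      using K s1 g1 by (intro mult_right_mono) auto
    finally show ?thesis
      by (simp add: g_def)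
  qed
  then show ?thesis
    using K by (intro exI[of _ K]) (auto simp: HJ_def)
qed

text \<open>
  Here \<open>w\<close> stands for \<open>\<Psi> u / u\<close>, which stays above \<open>\<delta> = \<Psi> 1\<close>. With \<open>y = N w / 2\<close> the
  left-hand side is \<open>N (ln 4 + ln u + ln y) + D\<close>, while the right-hand side is at least
  \<open>c N u ln (1 + y)\<close>. One of the \<open>c u\<close> copies of \<open>ln (1 + y)\<close> pays for \<open>ln y\<close>; each of the
  other \<open>c u - 1\<close> is at least the positive constant \<open>ln (1 + \<delta> / 2)\<close>, and together they
  outgrow \<open>ln u\<close>. The threshold for \<open>u\<close> therefore works for all \<open>N\<close> and \<open>w\<close> at once.
\<close>

lemma bennett_exponent_dominates:
  fixes c \<delta> D :: real
  assumes c: "0 < c" and \<delta>: "0 < \<delta>"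
  shows "\<forall>\<^sub>F u in at_top. \<forall>N\<ge>1. \<forall>w\<ge>\<delta>. \<forall>v>0. real N * v \<le> 2 / (u * w) \<longrightarrow>
     real N * ln (2 * real N * (u * w)) + D
       < c * (real N * u) * ln (1 + real N / (u * (real N * v)))"
proof -
  have "\<forall>\<^sub>F u in at_top. ln 4 + \<bar>D\<bar> + ln u < (c * u - 1) * ln (1 + \<delta> / 2)"
  proof -
    define l where "l = ln (1 + \<delta> / 2)"
    have "0 < l"
      using \<delta> by (simp add: l_def)
    then have "\<forall>\<^sub>F u in at_top. ln 4 + \<bar>D\<bar> + ln u < (c * u - 1) * l"
      using c by real_asymp
    then show ?thesis
      by (simp add: l_def)
  qed
  moreover have "\<forall>\<^sub>F u in at_top. 1 \<le> c * u" "\<forall>\<^sub>F u in at_top. (1 :: real) \<le> u"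
    using c by real_asymp+
  ultimately show ?thesis
  proof eventually_elim
    case (elim u)
    show ?case
    proof (intro allI impI)
      fix N :: nat and w v :: real
      assume N: "1 \<le> N" and w: "\<delta> \<le> w" and v: "0 < v" "real N * v \<le> 2 / (u * w)"
      define y where "y = real N * w / 2"
      have "1 * \<delta> \<le> real N * w"
        using N w \<delta> by (intro mult_mono) auto
      then have y: "\<delta> / 2 \<le> y" "0 < y"
        using \<delta> by (auto simp: y_def)
      have "ln (2 * real N * (u * w)) = ln (4 * u * y)"
        by (simp add: y_def field_simps)
      also have "\<dots> = ln 4 + ln u + ln y"
        using elim y by (simp add: ln_mult)
      also have "\<dots> < (c * u - 1) * ln (1 + \<delta> / 2) - \<bar>D\<bar> + ln (1 + y)"
      proof -
        have "ln y \<le> ln (1 + y)"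
          using y by simp
        then show ?thesis
          using elim by linarith
      qed
      also have "\<dots> \<le> (c * u - 1) * ln (1 + y) - \<bar>D\<bar> + ln (1 + y)"
        using elim y \<delta> by (intro add_mono diff_mono mult_left_mono) auto
      also have "\<dots> = c * u * ln (1 + y) - \<bar>D\<bar>"
        by (simp add: algebra_simps)
      finally have "real N * ln (2 * real N * (u * w)) < real N * (c * u * ln (1 + y) - \<bar>D\<bar>)"
        using N by simp
      moreover have "\<bar>D\<bar> \<le> real N * \<bar>D\<bar>"
        using N by (simp add: mult_le_cancel_right1)
      ultimately have "real N * ln (2 * real N * (u * w)) + D < c * (real N * u) * ln (1 + y)"
        by (simp add: algebra_simps)
      also have "\<dots> \<le> c * (real N * u) * ln (1 + real N / (u * (real N * v)))"
      proof -
        have "u * (real N * v) \<le> u * (2 / (u * w))"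
          using v elim by (intro mult_left_mono) auto
        also have "\<dots> = 2 / w"
          using elim by simp
        finally have "real N / (2 / w) \<le> real N / (u * (real N * v))"
          using N v elim w \<delta> by (intro divide_left_mono mult_pos_pos divide_pos_pos) auto
        then have "y \<le> real N / (u * (real N * v))"
          by (simp add: y_def)
        then show ?thesis
          using c elim y by (intro mult_left_mono ln_mono) auto
      qed
      finally show "real N * ln (2 * real N * (u * w)) + D
        < c * (real N * u) * ln (1 + real N / (u * (real N * v)))" .
    qed
  qed
qed

lemma HJ_of_bennett_type_tail:
  assumes \<Psi>: "orlicz_function \<Psi>" and C: "0 < C" and c: "0 < c"
    and tail: "\<And>N M X t. 1 \<le> N \<Longrightarrow> admissible M N X \<Longrightarrow> 0 < t \<Longrightarrow>
      measure M {\<omega> \<in> space M. (\<Sum>i=1..N. X i \<omega>) \<ge> t}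
        \<le> C * exp (- c * (t / orlicz_norm M \<Psi> (max_abs N X)) *
                ln (1 + t * orlicz_norm M \<Psi> (max_abs N X) /
                         (real N * prob_space.expectation M (\<lambda>\<omega>. (X 1 \<omega>)\<^sup>2))))
          + C / (\<Psi> (c * (t / orlicz_norm M \<Psi> (max_abs N X))) + 1)"
  shows "\<exists>K>0. HJ \<Psi> K"
proof -
  define D where "D = ln (2 * C)"
  have \<Psi>1: "0 < \<Psi> 1"
    using orlicz_function_pos[OF \<Psi>] by simp
  obtain u0 where u0: "\<And>u. u0 \<le> u \<Longrightarrow> 2 \<le> \<Psi> u \<and> 1 \<le> u \<and>
    (\<forall>N\<ge>1. \<forall>w\<ge>\<Psi> 1. \<forall>v>0. real N * v \<le> 2 / (u * w) \<longrightarrow>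
     real N * ln (2 * real N * (u * w)) + D
       < c * (real N * u) * ln (1 + real N / (u * (real N * v))))"
    using eventually_conj[OF orlicz_function_eventually_ge_2[OF \<Psi>]
        eventually_conj[OF eventually_ge_at_top[of 1] bennett_exponent_dominates[OF c \<Psi>1, of D]]]
    unfolding eventually_at_top_linorder by blast
  show ?thesis
  proof (rule HJ_of_sample_bound[OF \<Psi> c])
    show "0 < 1 + \<bar>D\<bar>"
      by simp
    show "1 \<le> u0" "\<And>u. u0 \<le> u \<Longrightarrow> 2 \<le> \<Psi> u"
      using u0 by auto
    fix N :: nat and u :: real
    assume N: "1 \<le> N" and "u0 \<le> u"
    note u = u0[OF this(2)]
    define L where "L = real N * ln (2 * real N * \<Psi> u)"
    have L: "0 \<le> L"
      unfolding L_def using N u by (intro mult_nonneg_nonneg ln_ge_zero) (auto intro: mult_ge1_I)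
    have tail_N: "measure M {\<omega> \<in> space M. (\<Sum>i=1..N. X i \<omega>) \<ge> real N}
        \<le> C * exp (- (c * (real N / orlicz_norm M \<Psi> (max_abs N X)) *
                ln (1 + real N * orlicz_norm M \<Psi> (max_abs N X) /
                         (real N * prob_space.expectation M (\<lambda>\<omega>. (X 1 \<omega>)\<^sup>2)))))
          + C / (\<Psi> (c * (real N / orlicz_norm M \<Psi> (max_abs N X))) + 1)"
      if "admissible M N X" for M X
      using tail[OF N that, of "real N"] N by (simp add: mult.assoc)
    have u': "0 < u" "2 \<le> \<Psi> u"
      using u by auto
    obtain v where v: "0 < v" "real N * v \<le> 2 / \<Psi> u"
      "c * (real N / (1 / u)) * ln (1 + real N * (1 / u) / (real N * v)) \<le> L + D
       \<or> orlicz_exponent \<Psi> (c * real N * u) \<le> L + D"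
      unfolding L_def D_def
      by (rule tail_bound_dichotomy[where
            E = "\<lambda>N v m. c * (real N / m) * ln (1 + real N * m / (real N * v))",
            OF \<Psi> C c tail_N N u'])
    define w where "w = \<Psi> u / u"
    have w: "\<Psi> 1 \<le> w" "u * w = \<Psi> u"
      using u orlicz_function_ge_linear[OF \<Psi>, of u] by (auto simp: w_def field_simps)
    \<comment> \<open>This rules out the exponential term.\<close>
    have "real N * ln (2 * real N * (u * w)) + D
        < c * (real N * u) * ln (1 + real N / (u * (real N * v)))"
      using u N v(1) v(2)[folded w(2)] w(1) by blast
    then have "L + D < c * (real N * u) * ln (1 + real N / (u * (real N * v)))"
      by (simp add: L_def w(2))
    then have "orlicz_exponent \<Psi> (c * real N * u) \<le> L + D"
      using v(3) by (simp add: field_simps)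
    also have "\<dots> \<le> (1 + \<bar>D\<bar>) * (L + 1)"
      using L by (rule add_le_mult_abs)
    finally show "orlicz_exponent \<Psi> (c * real N * u)
        \<le> (1 + \<bar>D\<bar>) * (real N * ln (2 * real N * \<Psi> u) + 1)"
      by (simp add: L_def)
  qed
qed

text \<open>
  The exponent \<open>c N\<^sup>2 / (N p + N / u)\<close> is at most \<open>c N u\<close>, while \<open>\<psi> u\<close> may itself be linear in
  \<open>u\<close>, so the exponential term cannot be excluded. When it is the dominant one, \<open>N u\<close> itself is
  bounded by a multiple of \<open>L + 1\<close>, and the assumed growth of \<open>\<Psi>\<close>, which bounds \<open>\<psi>\<close> by a
  linear function, closes the argument.
\<close>

lemma HJ_of_bernstein_type_tail:
  assumes \<Psi>: "orlicz_function \<Psi>" and C: "0 < C" and c: "0 < c"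
    and growth: "\<And>x. 0 \<le> x \<Longrightarrow> \<Psi> x \<le> C * exp (C * x)"
    and tail: "\<And>N M X t. 1 \<le> N \<Longrightarrow> admissible M N X \<Longrightarrow> 0 < t \<Longrightarrow>
      measure M {\<omega> \<in> space M. (\<Sum>i=1..N. X i \<omega>) \<ge> t}
        \<le> C * exp (- (c * t\<^sup>2 /
                  (real N * prob_space.expectation M (\<lambda>\<omega>. (X 1 \<omega>)\<^sup>2)
                     + t * orlicz_norm M \<Psi> (max_abs N X))))
          + C / (\<Psi> (c * (t / orlicz_norm M \<Psi> (max_abs N X))) + 1)"
  shows "\<exists>K>0. HJ \<Psi> K"
proof -
  define D where "D = ln (2 * C)"
  \<comment> \<open>Chosen so that \<open>N p + N / u \<le> d N / u\<close>, as \<open>N p \<le> 2 / \<Psi> u \<le> 2 / (u \<Psi> 1)\<close>.\<close>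
  define d where "d = 1 + 2 / \<Psi> 1"
  define B where "B = ln (1 + C) + (1 + C * d) * (1 + \<bar>D\<bar>)"
  have \<Psi>1: "0 < \<Psi> 1"
    using orlicz_function_pos[OF \<Psi>] by simp
  then have d: "1 \<le> d"
    by (simp add: d_def)
  obtain u0 where u0: "\<And>u. u0 \<le> u \<Longrightarrow> 2 \<le> \<Psi> u \<and> 1 \<le> u"
    using eventually_conj[OF orlicz_function_eventually_ge_2[OF \<Psi>] eventually_ge_at_top[of 1]]
    unfolding eventually_at_top_linorder by blast
  show ?thesis
  proof (rule HJ_of_sample_bound[OF \<Psi> c])
    show "0 < B"
      unfolding B_def using C d
      by (intro add_nonneg_pos mult_pos_pos add_pos_nonneg) (auto intro: mult_nonneg_nonneg)
    show "1 \<le> u0" "\<And>u. u0 \<le> u \<Longrightarrow> 2 \<le> \<Psi> u"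
      using u0 by auto
    fix N :: nat and u :: real
    assume N: "1 \<le> N" and "u0 \<le> u"
    note u = u0[OF this(2)]
    define L where "L = real N * ln (2 * real N * \<Psi> u)"
    define G where "G = orlicz_exponent \<Psi> (c * real N * u)"
    have L: "0 \<le> L"
      unfolding L_def using N u by (intro mult_nonneg_nonneg ln_ge_zero) (auto intro: mult_ge1_I)
    have LD: "L + D \<le> (1 + \<bar>D\<bar>) * (L + 1)"
      using L by (rule add_le_mult_abs)
    have lnC: "0 \<le> ln (1 + C)"
      using C by simp
    have tail_N: "measure M {\<omega> \<in> space M. (\<Sum>i=1..N. X i \<omega>) \<ge> real N}
        \<le> C * exp (- (c * (real N)\<^sup>2 /
                  (real N * prob_space.expectation M (\<lambda>\<omega>. (X 1 \<omega>)\<^sup>2)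
                     + real N * orlicz_norm M \<Psi> (max_abs N X))))
          + C / (\<Psi> (c * (real N / orlicz_norm M \<Psi> (max_abs N X))) + 1)"
      if "admissible M N X" for M X
      using tail[OF N that, of "real N"] N by simp
    have u': "0 < u" "2 \<le> \<Psi> u"
      using u by auto
    obtain v where v: "0 < v" "real N * v \<le> 2 / \<Psi> u"
      "c * (real N)\<^sup>2 / (real N * v + real N * (1 / u)) \<le> L + D \<or> G \<le> L + D"
      unfolding L_def D_def G_def
      by (rule tail_bound_dichotomy[where
            E = "\<lambda>N v m. c * (real N)\<^sup>2 / (real N * v + real N * m)", OF \<Psi> C c tail_N N u'])
    have "G \<le> ln (1 + C) + (1 + C * d) * ((1 + \<bar>D\<bar>) * (L + 1))"
      using v(3)
    proof
      assume "G \<le> L + D"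
      also have "\<dots> \<le> 1 * ((1 + \<bar>D\<bar>) * (L + 1))"
        using LD by simp
      also have "\<dots> \<le> (1 + C * d) * ((1 + \<bar>D\<bar>) * (L + 1))"
        using C d L by (intro mult_right_mono) auto
      finally show ?thesis
        using lnC by linarith
    next
      assume first: "c * (real N)\<^sup>2 / (real N * v + real N * (1 / u)) \<le> L + D"
      have "real N * v \<le> 2 / (u * \<Psi> 1)"
        using v(2) orlicz_function_ge_linear[OF \<Psi>, of u] u \<Psi>1
        by (elim order_trans) (auto intro!: divide_left_mono mult_pos_pos)
      also have "\<dots> \<le> real N * (2 / (u * \<Psi> 1))"
        using N u \<Psi>1 by (simp add: mult_le_cancel_right1 divide_right_mono)
      finally have "real N * v + real N * (1 / u) \<le> real N * d / u"
        using u \<Psi>1 by (simp add: d_def field_simps)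
      then have "c * (real N)\<^sup>2 / (real N * d / u) \<le> c * (real N)\<^sup>2 / (real N * v + real N * (1 / u))"
        using c N v(1) u d
        by (intro divide_left_mono mult_pos_pos divide_pos_pos add_pos_pos) auto
      also note first
      finally have "c * real N * u \<le> d * (L + D)"
        using N u d by (simp add: field_simps power2_eq_square)
      also have "\<dots> \<le> d * ((1 + \<bar>D\<bar>) * (L + 1))"
        using LD d by (intro mult_left_mono) auto
      finally have cNu: "c * real N * u \<le> d * ((1 + \<bar>D\<bar>) * (L + 1))" .
      have x: "0 \<le> c * real N * u"
        using c u by simp
      have "1 + \<Psi> (c * real N * u) \<le> exp (C * (c * real N * u)) + C * exp (C * (c * real N * u))"
        using growth[OF x] C x by (intro add_mono) auto
      also have "\<dots> = (1 + C) * exp (C * (c * real N * u))"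
        by (simp add: algebra_simps)
      finally have "G \<le> ln ((1 + C) * exp (C * (c * real N * u)))"
        unfolding G_def orlicz_exponent_def using \<Psi> x
        by (intro ln_mono) (auto simp: orlicz_function_def Pi_iff add_pos_nonneg)
      also have "\<dots> = ln (1 + C) + C * (c * real N * u)"
        using C by (simp add: ln_mult)
      also have "\<dots> \<le> ln (1 + C) + C * (d * ((1 + \<bar>D\<bar>) * (L + 1)))"
        using cNu C by (intro add_left_mono mult_left_mono) auto
      also have "\<dots> \<le> ln (1 + C) + (1 + C * d) * ((1 + \<bar>D\<bar>) * (L + 1))"
        using L by (simp add: algebra_simps)
      finally show ?thesis .
    qed
    also have "\<dots> \<le> B * (L + 1)"
      using mult_nonneg_nonneg[OF lnC L] by (simp add: B_def algebra_simps)
    finally show "orlicz_exponent \<Psi> (c * real N * u) \<le> B * (real N * ln (2 * real N * \<Psi> u) + 1)"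
      by (simp add: L_def G_def)
  qed
qed

theorem proposition4p5:
  fixes \<Psi> :: "real \<Rightarrow> real"
  assumes "orlicz_function \<Psi>"
  shows
    "((\<exists>C>0. \<exists>c>0. \<forall>N\<ge>1. \<forall>M X. admissible M N X \<longrightarrow>
         (\<forall>t>0.
            measure M {\<omega> \<in> space M. (\<Sum>i=1..N. X i \<omega>) \<ge> t}
              \<le> C * exp (- c * (t / orlicz_norm M \<Psi> (max_abs N X)) *
                      ln (1 + t * orlicz_norm M \<Psi> (max_abs N X) /
                               (real N * prob_space.expectation M (\<lambda>\<omega>. (X 1 \<omega>)\<^sup>2))))
                + C / (\<Psi> (c * (t / orlicz_norm M \<Psi> (max_abs N X))) + 1)))
      \<longrightarrow> (\<exists>K>0. HJ \<Psi> K))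
     \<and>
     ((\<exists>C>0. \<exists>c>0. (\<forall>x\<ge>0. \<Psi> x \<le> C * exp (C * x)) \<and>
         (\<forall>N\<ge>1. \<forall>M X. admissible M N X \<longrightarrow>
           (\<forall>t>0.
              measure M {\<omega> \<in> space M. (\<Sum>i=1..N. X i \<omega>) \<ge> t}
                \<le> C * exp (- (c * t\<^sup>2 /
                        (real N * prob_space.expectation M (\<lambda>\<omega>. (X 1 \<omega>)\<^sup>2)
                           + t * orlicz_norm M \<Psi> (max_abs N X))))
                  + C / (\<Psi> (c * (t / orlicz_norm M \<Psi> (max_abs N X))) + 1))))
      \<longrightarrow> (\<exists>K>0. HJ \<Psi> K))"
proof (intro conjI impI; elim exE conjE)
  fix C c :: real
  assume C: "0 < C" and c: "0 < c"
  {
    assume "\<forall>N\<ge>1. \<forall>M X. admissible M N X \<longrightarrow>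
         (\<forall>t>0.
            measure M {\<omega> \<in> space M. (\<Sum>i=1..N. X i \<omega>) \<ge> t}
              \<le> C * exp (- c * (t / orlicz_norm M \<Psi> (max_abs N X)) *
                      ln (1 + t * orlicz_norm M \<Psi> (max_abs N X) /
                               (real N * prob_space.expectation M (\<lambda>\<omega>. (X 1 \<omega>)\<^sup>2))))
                + C / (\<Psi> (c * (t / orlicz_norm M \<Psi> (max_abs N X))) + 1))"
    from HJ_of_bennett_type_tail[OF assms C c this[rule_format]] show "\<exists>K>0. HJ \<Psi> K" .
  next
    assume growth: "\<forall>x\<ge>0. \<Psi> x \<le> C * exp (C * x)"
      and tail: "\<forall>N\<ge>1. \<forall>M X. admissible M N X \<longrightarrow>
           (\<forall>t>0.
              measure M {\<omega> \<in> space M. (\<Sum>i=1..N. X i \<omega>) \<ge> t}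
                \<le> C * exp (- (c * t\<^sup>2 /
                        (real N * prob_space.expectation M (\<lambda>\<omega>. (X 1 \<omega>)\<^sup>2)
                           + t * orlicz_norm M \<Psi> (max_abs N X))))
                  + C / (\<Psi> (c * (t / orlicz_norm M \<Psi> (max_abs N X))) + 1))"
    from HJ_of_bernstein_type_tail[OF assms C c growth[rule_format] tail[rule_format]]
    show "\<exists>K>0. HJ \<Psi> K" .
  }
qed

end
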